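(* Let $P=(p_{i,j})\in\mathbb{R}_{>0}^{m\times n}$ be any weight matrix and $f:\mathbb{R}_{>0}\to\mathbb{R}_{>0}$ any function. Then the canonical load of the generalized proportional allocation exists and is unique: there exist $\mathbf{w}^*\in\mathbb{R}_{>0}^m$ and $\ell^*>0$ such that $\ell_i(P,f,\mathbf{w}^* )=\ell^*$ for all $i\in[m]$, and the value $\ell^*$ is the same for every such $\mathbf{w}^*$. Moreover, it is attained by a unique (up to scaling) set of parameters: if $\mathbf{w},\mathbf{w}'\in\mathbb{R}_{>0}^m$ both give all agents equal load, then $\mathbf{w}'=c\,\mathbf{w}$ for some $c>0$.
   Context: For $P\in\mathbb{R}_{>0}^{m\times n}$, a transformation function $f:\mathbb{R}_{>0}\to\mathbb{R}_{>0}$ and parameters $\mathbf{w}\in\mathbb{R}_{>0}^m$, the generalized proportional (GP) allocation is $x_{i,j}=\dfrac{f(p_{i,j})\,w_i}{\sum_{i'=1}^m f(p_{i',j})\,w_{i'}}$, and $\ell_i(P,f,\mathbf{w})=\sum_{j=1}^n p_{i,j}x_{i,j}$ is the load of agent $i$. A canonical allocation is a GP-allocation in which all agents have equal load; the corresponding parameters and common load are the canonical parameters $\mathbf{w}^*$ and the canonical load $\ell^*$. *)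

theory Defs
  imports "HOL-Analysis.Analysis"
begin

text \<open>Rows of \<open>P\<close> (index type \<open>'m\<close>) are the agents, columns (index type \<open>'n\<close>) the items.\<close>

definition pos_matrix :: "real ^ 'n ^ 'm \<Rightarrow> bool" where
  "pos_matrix P \<longleftrightarrow> (\<forall>i j. 0 < P $ i $ j)"

definition pos_vector :: "real ^ 'm \<Rightarrow> bool" where
  "pos_vector w \<longleftrightarrow> (\<forall>i. 0 < w $ i)"

definition gp_alloc ::
  "real ^ 'n ^ 'm \<Rightarrow> (real \<Rightarrow> real) \<Rightarrow> real ^ 'm \<Rightarrow> real ^ 'n ^ 'm" where
  "gp_alloc P f w =
     (\<chi> i j. f (P $ i $ j) * w $ i / (\<Sum>i'\<in>UNIV. f (P $ i' $ j) * w $ i'))"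

definition load ::
  "real ^ 'n ^ 'm \<Rightarrow> (real \<Rightarrow> real) \<Rightarrow> real ^ 'm \<Rightarrow> 'm \<Rightarrow> real" where
  "load P f w i = (\<Sum>j\<in>UNIV. P $ i $ j * gp_alloc P f w $ i $ j)"

text \<open>\<open>w\<close> are canonical parameters, and \<open>l\<close> is the common load that they induce.\<close>

definition canonical ::
  "real ^ 'n ^ 'm \<Rightarrow> (real \<Rightarrow> real) \<Rightarrow> real ^ 'm \<Rightarrow> real \<Rightarrow> bool" where
  "canonical P f w l \<longleftrightarrow> pos_vector w \<and> (\<forall>i. load P f w i = l)"

end

theory Submission
  imports Defs
begin

text \<open>
  The load of agent \<open>i\<close> is \<open>w\<^sub>i / G\<^sub>i(w)\<close> for a map \<open>G\<close> that is continuous and positive on the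
  whole closed simplex. By Brouwer, \<open>w \<mapsto> G(w) / \<Sum>\<^sub>i G\<^sub>i(w)\<close> has a fixed point there, which is
  positive because \<open>G\<close> is, and at which all loads agree. For uniqueness, scale \<open>w\<close> by the maximum
  \<open>c\<close> of the ratios \<open>w'\<^sub>i / w\<^sub>i\<close>: an agent attaining the maximum has the same numerators but no
  larger denominators under \<open>w'\<close> than under \<open>c w\<close>, so its load does not decrease, and it increases
  unless \<open>w' = c w\<close>. Exchanging the roles of \<open>w\<close> and \<open>w'\<close> gives the claim.
\<close>

definition total_weight ::
  "real ^ 'n ^ 'm \<Rightarrow> (real \<Rightarrow> real) \<Rightarrow> real ^ 'm \<Rightarrow> 'n \<Rightarrow> real" where
  "total_weight P f w j = (\<Sum>i\<in>UNIV. f (P $ i $ j) * w $ i)"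

text \<open>The factor \<open>w $ i\<close> is split off from the load, so that what remains stays
  positive at boundary points of the simplex where \<open>w $ i = 0\<close>. Its reciprocal is the
  map \<open>G\<close> to which Brouwer is applied.\<close>

definition unit_load ::
  "real ^ 'n ^ 'm \<Rightarrow> (real \<Rightarrow> real) \<Rightarrow> real ^ 'm \<Rightarrow> 'm \<Rightarrow> real" where
  "unit_load P f w i = (\<Sum>j\<in>UNIV. P $ i $ j * f (P $ i $ j) / total_weight P f w j)"

definition simplex_cart :: "(real ^ 'm) set" where
  "simplex_cart = {w. (\<forall>i. 0 \<le> w $ i) \<and> (\<Sum>i\<in>UNIV. w $ i) = 1}"

lemma load_eq: "load P f w i = w $ i * unit_load P f w i"
  unfolding load_def gp_alloc_def unit_load_def total_weight_def
  by (simp add: sum_distrib_left mult_ac)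

lemma compact_simplex_cart: "compact (simplex_cart :: (real ^ 'm) set)"
proof -
  have "norm w \<le> 1" if "w \<in> simplex_cart" for w :: "real ^ 'm"
    using norm_le_l1_cart[of w] that by (simp add: simplex_cart_def)
  then have "bounded (simplex_cart :: (real ^ 'm) set)"
    by (auto simp: bounded_iff)
  moreover have "closed (simplex_cart :: (real ^ 'm) set)"
    unfolding simplex_cart_def
    by (intro closed_Collect_conj closed_Collect_all closed_Collect_le closed_Collect_eq
        continuous_intros)
  ultimately show ?thesis
    by (simp add: compact_eq_bounded_closed)
qed

lemma convex_simplex_cart: "convex (simplex_cart :: (real ^ 'm) set)"
  by (auto simp: convex_def simplex_cart_def sum.distrib simp flip: sum_distrib_left)

lemma simplex_cart_nonempty: "(simplex_cart :: (real ^ 'm) set) \<noteq> {}"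
proof -
  have "(\<chi> i. 1 / real CARD('m)) \<in> (simplex_cart :: (real ^ 'm) set)"
    by (simp add: simplex_cart_def)
  then show ?thesis by blast
qed

context
  fixes P :: "real ^ 'n ^ 'm" and f :: "real \<Rightarrow> real"
  assumes P: "pos_matrix P" and f: "\<And>x. 0 < x \<Longrightarrow> 0 < f x"
begin

lemma P_pos: "0 < P $ i $ j"
  using P by (simp add: pos_matrix_def)

lemma fP_pos: "0 < f (P $ i $ j)"
  by (simp add: f P_pos)

text \<open>Every \<open>f (P $ i $ j)\<close> is positive, so a single positive coordinate of
  \<open>w\<close> makes the denominators of all columns positive. This covers the boundary of the
  simplex as well as its interior.\<close>

lemma total_weight_pos:
  assumes "\<And>i. 0 \<le> w $ i" and "0 < w $ k"
  shows "0 < total_weight P f w j"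
  unfolding total_weight_def
proof (rule sum_pos2)
  show "0 < f (P $ k $ j) * w $ k"
    by (simp add: assms fP_pos)
qed (auto simp: assms less_imp_le[OF fP_pos])

lemma unit_load_pos:
  assumes "\<And>j. 0 < total_weight P f w j"
  shows "0 < unit_load P f w i"
  unfolding unit_load_def by (rule sum_pos) (auto simp: assms P_pos fP_pos)

lemma total_weight_pos_simplex:
  assumes "w \<in> simplex_cart"
  shows "0 < total_weight P f w j"
proof -
  have nonneg: "\<And>i. 0 \<le> w $ i" and "(\<Sum>i\<in>UNIV. w $ i) = 1"
    using assms by (auto simp: simplex_cart_def)
  then obtain k where "w $ k \<noteq> 0"
    by (metis sum.neutral zero_neq_one)
  then show ?thesis
    using nonneg[of k] by (intro total_weight_pos[OF nonneg, of k]) simp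
qed

lemma canonical_exists: "\<exists>w l. 0 < l \<and> canonical P f w l"
proof -
  define G where "G w i = 1 / unit_load P f w i" for w i
  define N where "N w = (\<Sum>i\<in>UNIV. G w i)" for w
  define T :: "real ^ 'm \<Rightarrow> real ^ 'm" where "T w = (\<chi> i. G w i / N w)" for w
  have tw: "total_weight P f w j \<noteq> 0" and ul: "0 < unit_load P f w i"
    if "w \<in> simplex_cart" for w i j
    using total_weight_pos_simplex[OF that] unit_load_pos[of w i]
    by (auto simp: less_le)
  have G: "0 < G w i" if "w \<in> simplex_cart" for w i
    using ul[OF that] by (simp add: G_def)
  have N: "0 < N w" if "w \<in> simplex_cart" for w
    unfolding N_def by (rule sum_pos) (auto simp: G that)
  have cont_tw: "continuous_on simplex_cart (\<lambda>w. total_weight P f w j)" for j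
    unfolding total_weight_def by (intro continuous_intros)
  have cont_ul: "continuous_on simplex_cart (\<lambda>w. unit_load P f w i)" for i
    unfolding unit_load_def using tw by (intro continuous_intros cont_tw) auto
  have cont_G: "continuous_on simplex_cart (\<lambda>w. G w i)" for i
    unfolding G_def using ul by (intro continuous_intros cont_ul) (auto simp: less_le)
  have cont_N: "continuous_on simplex_cart N"
    unfolding N_def by (intro continuous_intros cont_G)
  have cont_T: "continuous_on simplex_cart T"
    unfolding T_def using N
    by (intro continuous_on_vec_lambda continuous_intros cont_G cont_N) (auto simp: less_le)
  have T_in: "T w \<in> simplex_cart" if "w \<in> simplex_cart" for w
    using G[OF that] N[OF that]
    by (auto simp: T_def simplex_cart_def less_imp_le N_def simp flip: sum_divide_distrib)
  obtain w where w: "w \<in> simplex_cart" and fix_w: "T w = w"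
    using brouwer[OF compact_simplex_cart convex_simplex_cart simplex_cart_nonempty cont_T] T_in
    by blast
  have w_eq: "w $ i = G w i / N w" for i
    using fix_w by (simp add: T_def vec_eq_iff)
  have "pos_vector w"
    by (simp add: pos_vector_def w_eq G[OF w] N[OF w])
  \<comment> \<open>Here \<open>unit_load P f w i\<close> is \<open>1 / G w i\<close>, so it cancels
    the numerator of \<open>w $ i = G w i / N w\<close> and leaves a value independent of
    \<open>i\<close>.\<close>
  moreover have "load P f w i = 1 / N w" for i
    using ul[OF w, of i] by (simp add: load_eq w_eq[of i] G_def)
  ultimately show ?thesis
    using N[OF w] by (auto simp: canonical_def intro!: exI[of _ w] exI[of _ "1 / N w"])
qed

text \<open>The agent \<open>i\<close> depends on the pair of vectors, but this does no harm when
  each vector gives all agents the same load. Either alternative yields a weak inequality of loads,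
  and equality forces the second one, hence proportionality.\<close>

lemma load_comparison:
  assumes w: "pos_vector w" and w': "pos_vector w'"
  shows "\<exists>i. load P f w i < load P f w' i \<or>
    load P f w i \<le> load P f w' i \<and> (\<exists>c>0. w' = c *\<^sub>R w)"
proof -
  have pos: "0 < w $ i" "0 < w' $ i" for i
    using w w' by (auto simp: pos_vector_def)
  have tw: "0 < total_weight P f w j" "0 < total_weight P f w' j" for j
    by (rule total_weight_pos; simp add: pos less_imp_le)+
  define c where "c = Max (range (\<lambda>i. w' $ i / w $ i))"
  have "c \<in> range (\<lambda>i. w' $ i / w $ i)"
    unfolding c_def by (rule Max_in) auto
  then obtain i where i: "c = w' $ i / w $ i"
    by blast
  have c: "0 < c" and w'i: "w' $ i = c * w $ i"
    using pos[of i] by (simp_all add: i)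
  have le: "w' $ k \<le> c * w $ k" for k
  proof -
    have "w' $ k / w $ k \<le> c"
      unfolding c_def by (rule Max_ge) auto
    then show ?thesis
      using pos[of k] by (simp add: divide_le_eq)
  qed
  \<comment> \<open>Moving \<open>c\<close> into the denominators gives this load the same factor
    \<open>w' $ i\<close> as the load under \<open>w'\<close>, so only the denominators remain to be
    compared.\<close>
  have load_i: "load P f w i =
      w' $ i * (\<Sum>j\<in>UNIV. P $ i $ j * f (P $ i $ j) / (c * total_weight P f w j))"
    using c by (simp add: load_eq unit_load_def w'i sum_distrib_left)
  have c_tw: "c * total_weight P f w j = (\<Sum>k\<in>UNIV. f (P $ k $ j) * (c * w $ k))" for j
    by (simp add: total_weight_def sum_distrib_left mult_ac)
  show ?thesis
  proof (cases "w' = c *\<^sub>R w")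
    case True
    have "total_weight P f w' j = c * total_weight P f w j" for j
      unfolding c_tw unfolding total_weight_def by (simp add: True)
    then have "load P f w i = load P f w' i"
      unfolding load_i load_eq[of P f w'] unit_load_def by simp
    then show ?thesis
      using True c by (intro exI[of _ i]) auto
  next
    case False
    then obtain k where "w' $ k \<noteq> c * w $ k"
      by (auto simp: vec_eq_iff)
    with le[of k] have k: "w' $ k < c * w $ k"
      by simp
    \<comment> \<open>The single strict coordinate \<open>k\<close> enters every column with the
      positive coefficient \<open>f (P $ k $ j)\<close>, so the inequality is strict in all columns
      at once.\<close>
    have "total_weight P f w' j < c * total_weight P f w j" for j
      unfolding c_tw unfolding total_weight_def
      by (rule sum_strict_mono_ex1)
        (use k in \<open>auto simp: le fP_pos less_imp_le[OF fP_pos] intro!: mult_left_mono exI[of _ k]\<close>)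
    then have "(\<Sum>j\<in>UNIV. P $ i $ j * f (P $ i $ j) / (c * total_weight P f w j)) <
        unit_load P f w' i"
      unfolding unit_load_def
      by (intro sum_strict_mono divide_strict_left_mono) (auto simp: P_pos fP_pos tw c)
    then have "load P f w i < load P f w' i"
      unfolding load_i load_eq[of P f w'] using pos by (simp add: mult_less_cancel_left_pos)
    then show ?thesis by blast
  qed
qed

lemma canonical_unique:
  assumes "canonical P f w l" and "canonical P f w' l'"
  shows "l = l'" and "\<exists>c>0. w' = c *\<^sub>R w"
proof -
  have "l < l' \<or> l \<le> l' \<and> (\<exists>c>0. w' = c *\<^sub>R w)"
    using load_comparison[of w w'] assms by (auto simp: canonical_def)
  \<comment> \<open>With the roles exchanged, both alternatives give this inequality. It excludes
    \<open>l < l'\<close> above, which leaves equal loads and proportional parameters.\<close>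
  moreover have "l' \<le> l"
    using load_comparison[of w' w] assms by (auto simp: canonical_def)
  ultimately show "l = l'" and "\<exists>c>0. w' = c *\<^sub>R w"
    by auto
qed

end

theorem theorem2p2:
  fixes P :: "real ^ 'n ^ 'm" and f :: "real \<Rightarrow> real"
  assumes "pos_matrix P"
    and "\<And>x. 0 < x \<Longrightarrow> 0 < f x"
  shows "(\<exists>w l. 0 < l \<and> canonical P f w l) \<and>
    (\<forall>w w' l l'. canonical P f w l \<and> canonical P f w' l' \<longrightarrow> l = l') \<and>
    (\<forall>w w' l l'. canonical P f w l \<and> canonical P f w' l' \<longrightarrow> (\<exists>c>0. w' = c *\<^sub>R w))"
  using canonical_exists[where f = f, OF assms] canonical_unique[where f = f, OF assms]
  by blast

end
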